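(* Let $p\in(0,1)$ be fixed. Then the exact set of variability of the second Taylor coefficient $a_2(f)$ of functions $f\in\Sigma^*(p,w_0)$, where only $p$ is fixed (and $w_0$ is allowed to vary over $\mathbb{C}\setminus\{0\}$), is the closed disc $|a_2(f)-1/p|\le p$; that is, $$ \left\{a_2(f) : f\in\Sigma^*(p,w_0)\text{ for some } w_0\in\mathbb{C}\setminus\{0\}\right\}=\left\{a\in\mathbb{C} : \left|a-\frac{1}{p}\right|\leq p\right\}. $$
   Context: Let $\mathbb{D}=\{z\in\mathbb{C}:|z|<1\}$ and $\overline{\mathbb{C}}=\mathbb{C}\cup\{\infty\}$. For $p\in(0,1)$ and a finite point $w_0\in\mathbb{C}$, $w_0\neq 0$, $\Sigma^*(p,w_0)$ denotes the class of functions $f$ that are meromorphic and univalent (injective) in $\mathbb{D}$, with a simple pole at $z=p$ and no other pole, normalized by $f(0)=0$ and $f'(0)=1$, and such that the complement $\overline{\mathbb{C}}\setminus f(\mathbb{D})$ is a starlike set with respect to $w_0$ (it contains $w_0$ and, with each of its points $w$, the line segment from $w_0$ to $w$). Each $f\in\Sigma^*(p,w_0)$ has a Taylor expansion $f(z)=z+\sum_{n=2}^{\infty}a_n(f)z^n$ for $|z|<p$, which defines $a_2(f)$. *)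

theory Defs
  imports "HOL-Complex_Analysis.Complex_Analysis"
begin

text \<open>
  The extended complex plane is rendered as \<open>complex option\<close>, with \<open>None\<close> as the point at
  infinity (as in \<open>Alexandroff_compactification\<close>). The HOL function representing a meromorphic
  function carries a dummy value at each pole; the sphere-valued function below discards it, so
  that injectivity and the image are those of the meromorphic function itself.
\<close>

definition sphere_map :: "(complex \<Rightarrow> complex) \<Rightarrow> complex \<Rightarrow> complex option" where
  "sphere_map f z = (if is_pole f z then None else Some (f z))"

text \<open>
  Only segments between finite points are considered. This is enough for the complement of the
  image of a function that has a pole, since that complement does not contain infinity.
\<close>

definition starlike_wrt :: "complex \<Rightarrow> complex option set \<Rightarrow> bool" where
  "starlike_wrt w\<^sub>0 K \<longleftrightarrow>
     Some w\<^sub>0 \<in> K \<and> (\<forall>w. Some w \<in> K \<longrightarrow> Some ` closed_segment w\<^sub>0 w \<subseteq> K)"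

text \<open>
  The predicate \<open>nicely_meromorphic_on\<close> (rather than \<open>meromorphic_on\<close>) excludes removable
  singularities at which the HOL function has a wrong value; its convention
  \<open>f p = 0\<close> at the pole is immaterial. A simple pole is a pole of order \<open>-1\<close> in
  the sense of \<open>zorder\<close>.
\<close>

definition Sigma_star :: "real \<Rightarrow> complex \<Rightarrow> (complex \<Rightarrow> complex) set" where
  "Sigma_star p w\<^sub>0 =
     {f. f nicely_meromorphic_on ball 0 1 \<and>
         inj_on (sphere_map f) (ball 0 1) \<and>
         (\<forall>z\<in>ball 0 1. is_pole f z \<longleftrightarrow> z = of_real p) \<and>
         zorder f (of_real p) = -1 \<and>
         f 0 = 0 \<and> deriv f 0 = 1 \<and>
         starlike_wrt w\<^sub>0 (UNIV - sphere_map f ` ball 0 1)}"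

definition taylor_coeff :: "nat \<Rightarrow> (complex \<Rightarrow> complex) \<Rightarrow> complex" where
  "taylor_coeff n f = fps_nth (fps_expansion f 0) n"

end

theory Submission
  imports Defs
begin

text \<open>
  Let \<open>m\<close> be the disc automorphism that moves the pole \<open>p\<close> to \<open>0\<close>. Then \<open>f\<close> lies in the class
  for \<open>w\<^sub>0\<close> iff \<open>f = w\<^sub>0 + 1 / (F \<circ> m)\<close> with \<open>F\<close> univalent, \<open>F 0 = 0\<close> and \<open>F\<close> of starlike image;
  the normalization of \<open>f\<close> only fixes the scale of \<open>F\<close> and determines \<open>w\<^sub>0\<close>. Starlike \<open>F\<close> are
  those with \<open>z F' / F = (1 + z \<psi>) / (1 - z \<psi>)\<close> for a Schur function \<open>\<psi>\<close>, and in these terms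
  \<open>a\<^sub>2 - 1/p = - p (1 - p\<^sup>2) (d - s\<^sup>2) / (1 - p\<^sup>2 s\<^sup>2)\<close> where \<open>s = \<psi> (- p)\<close> and \<open>d = \<psi>' (- p)\<close>.
  The Schwarz--Pick inequality for \<open>\<psi>\<close> at \<open>- p\<close> bounds this by \<open>p\<close>, and multiples of the
  automorphism vanishing at \<open>- p\<close> attain every value.
\<close>

subsection \<open>The Schwarz--Pick inequality\<close>

lemma Schwarz_Pick_deriv_strict:
  assumes holf: "f holomorphic_on ball 0 1"
    and bound: "\<And>z. cmod z < 1 \<Longrightarrow> cmod (f z) < 1"
    and w: "cmod w < 1"
  shows "(1 - (cmod w)\<^sup>2) * cmod (deriv f w) \<le> 1 - (cmod (f w))\<^sup>2"
proof -
  define M where "M = Moebius_function 0 (f w)"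
  define N where "N = Moebius_function 0 (- w)"
  define g where "g = (\<lambda>z. M (f (N z)))"
  have fw: "cmod (f w) < 1" using bound w by blast
  have N0: "N 0 = w" by (simp add: N_def Moebius_function_simple)
  have Nlt: "cmod (N z) < 1" if "cmod z < 1" for z
    unfolding N_def using w that by (intro Moebius_function_norm_lt_1) auto
  have Mlt: "cmod (M z) < 1" if "cmod z < 1" for z
    unfolding M_def using fw that by (intro Moebius_function_norm_lt_1) auto
  have holM: "M holomorphic_on ball 0 1" and holN: "N holomorphic_on ball 0 1"
    unfolding M_def N_def using fw w by (auto intro!: Moebius_function_holomorphic)
  have "(f \<circ> N) holomorphic_on ball 0 1"
    using holN holf by (rule holomorphic_on_compose_gen) (use Nlt in auto)
  hence "(M \<circ> (f \<circ> N)) holomorphic_on ball 0 1"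
    using holM by (rule holomorphic_on_compose_gen) (use Nlt bound in auto)
  hence holg: "g holomorphic_on ball 0 1" by (simp add: g_def o_def)
  have g0: "g 0 = 0" by (simp add: g_def N0 M_def Moebius_function_eq_zero)
  have "cmod (deriv g 0) \<le> 1"
    by (rule Schwarz_Lemma(2)[OF holg g0 _, of 0]) (auto simp: g_def intro!: Mlt bound Nlt)
  moreover have "deriv g 0 = of_real (1 - (cmod w)\<^sup>2) * deriv f w / of_real (1 - (cmod (f w))\<^sup>2)"
  proof (rule DERIV_imp_deriv)
    have nw: "w * cnj w = of_real ((cmod w)\<^sup>2)" and nf: "f w * cnj (f w) = of_real ((cmod (f w))\<^sup>2)"
      by (metis complex_norm_square of_real_power)+
    have dN: "(N has_field_derivative of_real (1 - (cmod w)\<^sup>2)) (at 0)"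
      unfolding N_def Moebius_function_simple
      by (rule derivative_eq_intros refl | simp)+ (use nw in \<open>simp add: algebra_simps\<close>)
    have df: "(f has_field_derivative deriv f w) (at (N 0))"
      using holf w N0 by (simp add: holomorphic_derivI)
    have ne: "1 - (cmod (f w))\<^sup>2 \<noteq> 0"
      using fw by (simp add: abs_square_eq_1)
    have ne': "1 - cnj (f w) * f w \<noteq> 0"
      using ne nf by (metis mult.commute of_real_1 of_real_diff of_real_eq_0_iff)
    have e: "of_real (1 - (cmod (f w))\<^sup>2) = 1 - cnj (f w) * f w"
      using nf by (simp add: mult.commute)
    have dM: "(M has_field_derivative 1 / of_real (1 - (cmod (f w))\<^sup>2)) (at (f (N 0)))"
      unfolding M_def Moebius_function_simple N0 e
      by (rule derivative_eq_intros refl ne')+ (use ne' in \<open>simp add: divide_simps\<close>)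
    have "(g has_field_derivative 1 / of_real (1 - (cmod (f w))\<^sup>2) * (deriv f w * of_real (1 - (cmod w)\<^sup>2))) (at 0)"
      unfolding g_def by (intro DERIV_chain2[of M] DERIV_chain2[of f] dM df dN)
    thus "(g has_field_derivative of_real (1 - (cmod w)\<^sup>2) * deriv f w / of_real (1 - (cmod (f w))\<^sup>2)) (at 0)"
      by (simp only: mult_ac divide_inverse mult_1)
  qed
  ultimately have "\<bar>1 - (cmod w)\<^sup>2\<bar> * cmod (deriv f w) / \<bar>1 - (cmod (f w))\<^sup>2\<bar> \<le> 1"
    by (simp only: norm_mult norm_divide norm_of_real)
  moreover have "0 < 1 - (cmod (f w))\<^sup>2" "0 < 1 - (cmod w)\<^sup>2"
    using fw w by (simp_all add: abs_square_less_1)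
  ultimately show ?thesis
    by (simp add: divide_simps del: zero_less_diff diff_gt_0_iff_gt split: if_splits)
qed

lemma Schwarz_Pick_deriv:
  assumes holf: "f holomorphic_on ball 0 1"
    and bound: "\<And>z. cmod z < 1 \<Longrightarrow> cmod (f z) \<le> 1"
    and w: "cmod w < 1"
  shows "(1 - (cmod w)\<^sup>2) * cmod (deriv f w) \<le> 1 - (cmod (f w))\<^sup>2"
proof (rule tendsto_le)
  show "((\<lambda>r. 1 - (r * cmod (f w))\<^sup>2) \<longlongrightarrow> 1 - (cmod (f w))\<^sup>2) (at_left 1)"
    by (auto intro!: tendsto_eq_intros)
  show "((\<lambda>r. (1 - (cmod w)\<^sup>2) * (r * cmod (deriv f w))) \<longlongrightarrow> (1 - (cmod w)\<^sup>2) * cmod (deriv f w)) (at_left 1)"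
    by (auto intro!: tendsto_eq_intros)
  show "\<forall>\<^sub>F r in at_left (1::real). (1 - (cmod w)\<^sup>2) * (r * cmod (deriv f w)) \<le> 1 - (r * cmod (f w))\<^sup>2"
  proof (rule eventually_at_leftI[of 0])
    fix r :: real assume r: "r \<in> {0<..<1}"
    have "cmod (of_real r * f z) < 1" if "cmod z < 1" for z
    proof -
      have "r * cmod (f z) \<le> r * 1"
        using bound[OF that] r by (intro mult_left_mono) auto
      also have "\<dots> < 1" using r by simp
      finally show ?thesis using r by (simp add: norm_mult)
    qed
    hence "(1 - (cmod w)\<^sup>2) * cmod (deriv (\<lambda>z. of_real r * f z) w) \<le> 1 - (cmod (of_real r * f w))\<^sup>2"
      using holf w by (intro Schwarz_Pick_deriv_strict holomorphic_intros)
    moreover have "f field_differentiable at w"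
      using holf w holomorphic_on_imp_differentiable_at[OF holf] by simp
    ultimately show "(1 - (cmod w)\<^sup>2) * (r * cmod (deriv f w)) \<le> 1 - (r * cmod (f w))\<^sup>2"
      using r by (simp add: norm_mult)
  qed auto
qed auto

subsection \<open>Starlike functions and Schur functions\<close>

lemma Re_difference_quotient_pos:
  assumes "convex S" "open S" "f holomorphic_on S"
    and pos: "\<And>z. z \<in> S \<Longrightarrow> 0 < Re (deriv f z)"
    and "a \<in> S" "b \<in> S" "a \<noteq> b"
  shows "0 < Re ((f b - f a) / (b - a))"
proof -
  have seg: "closed_segment a b \<subseteq> S"
    using assms by (simp add: closed_segment_subset)
  have "((\<lambda>z. f z / (b - a)) has_field_derivative deriv f u / (b - a)) (at u)"
    if "u \<in> closed_segment a b" for u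
    using assms seg that by (intro DERIV_cdivide holomorphic_derivI[of _ S]) auto
  from complex_mvt_line[of a b, OF this] obtain u where u: "u \<in> closed_segment a b"
    "Re (f b / (b - a)) - Re (f a / (b - a)) = Re (deriv f u / (b - a) * (b - a))"
    by blast
  thus ?thesis using pos[of u] seg \<open>a \<noteq> b\<close> by (auto simp: diff_divide_distrib)
qed

text \<open>
  In the coordinate \<open>z = exp s\<close> the logarithm of \<open>z exp (L z)\<close> becomes \<open>\<Phi> s = s + L (exp s)\<close> on the
  left half-plane. That domain is convex and \<open>Re \<Phi>' > 0\<close>, so the Noshiro--Warschawski argument
  yields injectivity and, as \<open>\<Phi> b - \<Phi> a = ln t\<close> is real, also the sign of \<open>Re (b - a)\<close>.
\<close>

lemma starlike_radial_comparison:
  assumes holL: "L holomorphic_on ball 0 1"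
    and pos: "\<And>z. cmod z < 1 \<Longrightarrow> 0 < Re (1 + z * deriv L z)"
    and z: "cmod z < 1" "z \<noteq> 0" and w: "cmod w < 1" "w \<noteq> 0"
    and t: "0 < t" "t \<le> 1" and eq: "w * exp (L w) = of_real t * (z * exp (L z))"
  shows "w = z \<or> t < 1 \<and> cmod w < cmod z"
proof -
  define H where "H = {s. Re s < 0}"
  define \<Phi> where "\<Phi> = (\<lambda>s. s + L (exp s))"
  have H: "convex H" "open H"
    by (simp_all add: H_def convex_halfspace_Re_lt open_halfspace_Re_lt)
  have expH: "cmod (exp s) < 1" if "s \<in> H" for s
    using that by (simp add: H_def)
  have d\<Phi>: "(\<Phi> has_field_derivative 1 + exp s * deriv L (exp s)) (at s)" if "s \<in> H" for s
  proof -
    have "(L has_field_derivative deriv L (exp s)) (at (exp s))"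
      using holL expH[OF that] by (intro holomorphic_derivI) auto
    from DERIV_chain2[OF this DERIV_exp] show ?thesis
      unfolding \<Phi>_def by (auto intro!: derivative_eq_intros simp: mult_ac)
  qed
  have hol\<Phi>: "\<Phi> holomorphic_on H"
    using d\<Phi> H by (auto simp: holomorphic_on_open)
  have pos\<Phi>: "0 < Re (deriv \<Phi> s)" if "s \<in> H" for s
    using pos[OF expH[OF that]] DERIV_imp_deriv[OF d\<Phi>[OF that]] by simp
  define a where "a = ln z"
  have za: "z = exp a" using z by (simp add: a_def)
  have "exp (ln w + L w) = exp (of_real (ln t) + (a + L z))"
    using eq z w t by (simp add: exp_add a_def exp_of_real)
  then obtain n :: int where n: "ln w + L w = of_real (ln t) + (a + L z) + (of_int (2 * n) * pi) * \<i>"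
    using exp_eq by auto
  define b where "b = ln w - (of_int (2 * n) * pi) * \<i>"
  have wb: "w = exp b"
    using w unfolding b_def exp_diff
    by (metis (no_types, lifting) div_by_1 exp_Ln exp_integer_2pi Ints_of_int mult.assoc mult.commute mult_2 of_int_mult of_int_numeral)
  have \<Phi>b: "\<Phi> b - \<Phi> a = of_real (ln t)"
  proof -
    have "\<Phi> b - \<Phi> a = (ln w + L w) - (a + L z) - (of_int (2 * n) * pi) * \<i>"
      unfolding \<Phi>_def wb[symmetric] za[symmetric] by (simp add: b_def)
    thus ?thesis unfolding n by simp
  qed
  have abH: "a \<in> H" "b \<in> H"
    using z w unfolding H_def by (auto simp: za wb)
  show ?thesis
  proof (cases "a = b")
    case True thus ?thesis using za wb by simp
  next
    case False
    have "0 < Re (of_real (ln t) / (b - a))"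
      using Re_difference_quotient_pos[OF H hol\<Phi> pos\<Phi> abH False] \<Phi>b by simp
    hence *: "0 < ln t * Re (b - a) / (cmod (b - a))\<^sup>2"
      by (simp add: Re_divide cmod_power2 Re_divide')
    have "ln t \<le> 0" using t by simp
    with * have "ln t < 0" "Re (b - a) < 0"
      by (auto simp: zero_less_divide_iff zero_less_mult_iff)
    thus ?thesis using t by (auto simp: za wb)
  qed
qed

definition starlike_function :: "(complex \<Rightarrow> complex) \<Rightarrow> bool" where
  "starlike_function F \<longleftrightarrow> F holomorphic_on ball 0 1 \<and> inj_on F (ball 0 1) \<and> F 0 = 0 \<and>
     (\<forall>z\<in>ball 0 1. \<forall>t\<in>{0..1}. of_real t * F z \<in> F ` ball 0 1)"

lemma starlike_functionI_log_derivative: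
  assumes holL: "L holomorphic_on ball 0 1"
    and pos: "\<And>z. cmod z < 1 \<Longrightarrow> 0 < Re (1 + z * deriv L z)"
  shows "starlike_function (\<lambda>z. z * exp (L z))"
proof -
  define F where "F = (\<lambda>z. z * exp (L z))"
  have holF: "F holomorphic_on ball 0 1"
    unfolding F_def by (intro holomorphic_intros holL)
  have F0: "F z = 0 \<longleftrightarrow> z = 0" for z by (simp add: F_def)
  have comp: "w = z \<or> t < 1 \<and> cmod w < cmod z"
    if "cmod z < 1" "cmod w < 1" "z \<noteq> 0" "0 < t" "t \<le> 1" "F w = of_real t * F z" for z w t
  proof -
    have "w \<noteq> 0" using that F0[of w] F0[of z] by auto
    thus ?thesis
      using starlike_radial_comparison[OF holL pos, of z w t] that by (simp add: F_def)
  qed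
  have inj: "inj_on F (ball 0 1)"
  proof (rule inj_onI)
    fix w z assume wz: "w \<in> ball 0 1" "z \<in> ball 0 1" "F w = F z"
    show "w = z"
    proof (cases "z = 0")
      case True thus ?thesis using wz F0[of w] F0[of z] by simp
    next
      case False thus ?thesis using comp[of z w 1] wz by simp
    qed
  qed
  have star: "of_real t * F z \<in> F ` ball 0 1" if z: "z \<in> ball 0 1" and t: "t \<in> {0..1}" for z t
  proof (cases "z = 0 \<or> t = 0")
    case True
    hence "of_real t * F z = F 0" by (auto simp: F0)
    thus ?thesis by simp
  next
    case False
    define S where "S = {0<..1} \<inter> (\<lambda>t. of_real t * F z) -` (F ` ball 0 1)"
    have cont: "continuous_on {0<..1} (\<lambda>t. of_real t * F z)"
      by (intro continuous_intros)
    have "open (F ` ball 0 1)"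
      by (rule open_mapping_thm3[OF holF _ inj]) simp
    hence op: "openin (top_of_set {0<..1}) S"
      unfolding S_def by (rule continuous_openin_preimage_gen[OF cont])
    have "cmod w \<le> cmod z" if "cmod w < 1" "0 < s" "s \<le> 1" "of_real s * F z = F w" for w s
      using comp[of z w s] that z False by auto
    hence "of_real s * F z \<in> F ` ball 0 1 \<longleftrightarrow> of_real s * F z \<in> F ` cball 0 (cmod z)"
      if "s \<in> {0<..1}" for s
      using that z unfolding image_iff mem_ball_0 mem_cball_0 Bex_def greaterThanAtMost_iff
      by (meson order_le_less_trans)
    hence "S = {0<..1} \<inter> (\<lambda>t. of_real t * F z) -` (F ` cball 0 (cmod z))"
      unfolding S_def vimage_def by blast
    moreover have "closed (F ` cball 0 (cmod z))"
      using z by (intro compact_imp_closed compact_continuous_image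
          holomorphic_on_imp_continuous_on[OF holomorphic_on_subset[OF holF]]) auto
    ultimately have cl: "closedin (top_of_set {0<..1}) S"
      using continuous_closedin_preimage[OF cont] by simp
    have "1 \<in> S" using z by (simp add: S_def)
    hence "S = {0<..1}"
      using op cl connected_clopen[of "{0<..1::real}"] by (metis connected_Ioc empty_iff)
    thus ?thesis using t False by (auto simp: S_def)
  qed
  show ?thesis
    using holF inj star by (simp add: starlike_function_def F_def)
qed

lemma starlike_function_exists:
  fixes \<psi> :: "complex \<Rightarrow> complex"
  assumes hol: "\<psi> holomorphic_on ball 0 1"
    and bound: "\<And>z. cmod z < 1 \<Longrightarrow> cmod (\<psi> z) \<le> 1"
  obtains F where "starlike_function F"
    "\<And>z. cmod z < 1 \<Longrightarrow> z * deriv F z * (1 - z * \<psi> z) = F z * (1 + z * \<psi> z)"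
proof -
  have lt: "cmod (z * \<psi> z) < 1" if "cmod z < 1" for z
  proof -
    have "cmod (z * \<psi> z) \<le> cmod z * 1"
      unfolding norm_mult using bound[OF that] by (intro mult_left_mono) auto
    thus ?thesis using that by simp
  qed
  hence ne: "1 - z * \<psi> z \<noteq> 0" if "cmod z < 1" for z
    using that by fastforce
  have "(\<lambda>z. 2 * \<psi> z / (1 - z * \<psi> z)) holomorphic_on ball 0 1"
    using ne by (intro holomorphic_intros hol) auto
  then obtain L where L': "\<And>z. z \<in> ball 0 1 \<Longrightarrow>
      (L has_field_derivative 2 * \<psi> z / (1 - z * \<psi> z)) (at z within ball 0 1)"
    using holomorphic_convex_primitive'[OF convex_ball open_ball] by blast
  have L: "(L has_field_derivative 2 * \<psi> z / (1 - z * \<psi> z)) (at z)" if "cmod z < 1" for z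
    using L'[of z] that at_within_open[of z "ball 0 1"] by simp
  have holL: "L holomorphic_on ball 0 1"
    by (auto simp: holomorphic_on_open intro!: exI L)
  have q: "1 + z * deriv L z = (1 + z * \<psi> z) / (1 - z * \<psi> z)" if "cmod z < 1" for z
    unfolding DERIV_imp_deriv[OF L[OF that]] using ne[OF that] by (simp add: field_simps)
  have pos: "0 < Re (1 + z * deriv L z)" if "cmod z < 1" for z
  proof -
    have "0 < 1 - (cmod (z * \<psi> z))\<^sup>2"
      using lt[OF that] by (simp add: abs_square_less_1)
    also have "\<dots> = Re ((1 + z * \<psi> z) * cnj (1 - z * \<psi> z))"
      unfolding cmod_power2 by (simp add: power2_eq_square algebra_simps)
    finally show ?thesis
      unfolding q[OF that] using ne[OF that] by (simp add: Re_complex_div_gt_0)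
  qed
  have "z * deriv (\<lambda>z. z * exp (L z)) z * (1 - z * \<psi> z) = z * exp (L z) * (1 + z * \<psi> z)"
    if z: "cmod z < 1" for z
  proof -
    have "((\<lambda>z. z * exp (L z)) has_field_derivative exp (L z) * (1 + z * deriv L z)) (at z)"
      using L[OF z] DERIV_imp_deriv[OF L[OF z]]
      by (auto intro!: derivative_eq_intros simp: algebra_simps)
    thus ?thesis
      unfolding q[OF z] using ne[OF z] by (simp add: DERIV_imp_deriv)
  qed
  thus thesis
    using that starlike_functionI_log_derivative[OF holL pos] by blast
qed

text \<open>
  With \<open>g = F\<^sup>-\<^sup>1\<close>, the Schwarz lemma gives \<open>|g (t F z)| \<le> |z|\<close> for \<open>t \<le> 1\<close>, with equality at \<open>t = 1\<close>;
  the claim is the sign of the left derivative there.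
\<close>

lemma starlike_function_Re_nonneg:
  assumes F: "starlike_function F" and z: "cmod z < 1"
  shows "0 \<le> Re (cnj z * (F z / deriv F z))"
proof -
  have holF: "F holomorphic_on ball 0 1" and inj: "inj_on F (ball 0 1)" and F0: "F 0 = 0"
    and star: "\<And>z t. \<lbrakk>cmod z < 1; 0 \<le> t; t \<le> 1\<rbrakk> \<Longrightarrow> of_real t * F z \<in> F ` ball 0 1"
    using F by (auto simp: starlike_function_def)
  obtain g where holg: "g holomorphic_on (F ` ball 0 1)"
    and dg: "\<And>z. z \<in> ball 0 1 \<Longrightarrow> deriv F z * deriv g (F z) = 1"
    and gF: "\<And>z. z \<in> ball 0 1 \<Longrightarrow> g (F z) = z"
    using holomorphic_has_inverse[OF holF _ inj] by auto
  have opn: "open (F ` ball 0 1)"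
    by (rule open_mapping_thm3[OF holF _ inj]) simp
  have contract: "cmod (g (of_real t * F z)) \<le> cmod z" if "0 \<le> t" "t \<le> 1" for t
  proof (rule Schwarz_Lemma(1)[of "\<lambda>z. g (of_real t * F z)"])
    have "(\<lambda>z. of_real t * F z) holomorphic_on ball 0 1"
      by (intro holomorphic_intros holF)
    hence "(g \<circ> (\<lambda>z. of_real t * F z)) holomorphic_on ball 0 1"
      using holg by (rule holomorphic_on_compose_gen) (use star that in auto)
    thus "(\<lambda>z. g (of_real t * F z)) holomorphic_on ball 0 1" by (simp add: o_def)
    show "g (of_real t * F 0) = 0" using gF[of 0] by (simp add: F0)
    show "cmod (g (of_real t * F z)) < 1" if "cmod z < 1" for z
      using star[OF that \<open>0 \<le> t\<close> \<open>t \<le> 1\<close>] gF by auto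
  qed (use z in auto)
  define w where "w = F z * deriv g (F z)"
  have w: "w = F z / deriv F z"
  proof -
    have "deriv F z * deriv g (F z) = 1" using dg z by simp
    hence "deriv g (F z) = 1 / deriv F z"
      by (metis nonzero_eq_divide_eq mult.commute mult_zero_left zero_neq_one)
    thus ?thesis by (simp add: w_def)
  qed
  define h where "h = (\<lambda>t. (cmod (g (of_real t * F z)))\<^sup>2)"
  have "(g has_field_derivative deriv g (F z)) (at (of_real 1 * F z))"
    using holg opn z by (auto intro!: holomorphic_derivI[of _ "F ` ball 0 1"])
  moreover have "((\<lambda>t. of_real t * F z) has_vector_derivative F z) (at 1)"
    unfolding has_vector_derivative_def
    by (auto intro!: derivative_eq_intros simp: scaleR_conv_of_real)
  ultimately have "((\<lambda>t. g (of_real t * F z)) has_vector_derivative w) (at 1)"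
    using field_vector_diff_chain_at[of "\<lambda>t. of_real t * F z" "F z" 1 g] by (simp add: o_def w_def)
  from bounded_bilinear.has_vector_derivative[OF bounded_bilinear_inner this this]
  have "(h has_real_derivative 2 * (z \<bullet> w)) (at 1)"
    using gF[of z] z
    by (simp add: h_def has_real_derivative_iff_has_vector_derivative power2_norm_eq_inner inner_commute)
  moreover have "\<exists>s>0. s < d \<and> h (1 - s) \<le> h 1" if "0 < d" for d
  proof (intro exI conjI)
    show "h (1 - min (d / 2) 1) \<le> h 1"
      using contract[of "1 - min (d / 2) 1"] gF[of z] z that by (simp add: h_def power_mono)
  qed (use that in auto)
  ultimately have "0 \<le> 2 * (z \<bullet> w)"
    using DERIV_neg_dec_left[of h "2 * (z \<bullet> w)" 1] by (meson not_le)
  moreover have "z \<bullet> w = Re (cnj z * w)" by (simp add: inner_complex_def)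
  ultimately show ?thesis by (simp add: w)
qed


lemma Schwarz_quotient_bound:
  fixes \<psi> :: "complex \<Rightarrow> complex"
  assumes hol: "\<psi> holomorphic_on ball 0 1"
    and bound: "\<And>z. cmod z < 1 \<Longrightarrow> cmod (z * \<psi> z) \<le> 1"
    and z: "cmod z < 1"
  shows "cmod (\<psi> z) \<le> 1"
proof (rule field_le_mult_one_interval)
  fix r :: real assume r: "0 < r" "r < 1"
  define h where "h = (\<lambda>z. of_real r * (z * \<psi> z))"
  have holh: "h holomorphic_on ball 0 1"
    unfolding h_def by (intro holomorphic_intros hol)
  have h0: "h 0 = 0" by (simp add: h_def)
  have lt: "cmod (h z) < 1" if "cmod z < 1" for z
  proof -
    have "cmod (h z) \<le> r * 1"
      unfolding h_def norm_mult[of "of_real r"] using bound[OF that] r by (intro mult_mono) auto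
    thus ?thesis using r by simp
  qed
  show "r * cmod (\<psi> z) \<le> 1"
  proof (cases "z = 0")
    case True
    have "(\<psi> has_field_derivative deriv \<psi> 0) (at 0)"
      using hol by (intro holomorphic_derivI[of _ "ball 0 1"]) auto
    hence "(h has_field_derivative of_real r * \<psi> 0) (at 0)"
      unfolding h_def by (auto intro!: derivative_eq_intros)
    thus ?thesis
      using Schwarz_Lemma(2)[OF holh h0 lt, of 0] r True by (simp add: DERIV_imp_deriv norm_mult)
  next
    case False
    have "r * cmod (\<psi> z) * cmod z \<le> 1 * cmod z"
      using Schwarz_Lemma(1)[OF holh h0 lt z] r by (simp add: h_def norm_mult mult_ac)
    thus ?thesis using False by (simp only: mult_le_cancel_right) simp
  qed
qed

lemma starlike_function_Schur:
  assumes F: "starlike_function F"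
  obtains \<psi> :: "complex \<Rightarrow> complex" where "\<psi> holomorphic_on ball 0 1" "\<And>z. cmod z < 1 \<Longrightarrow> cmod (\<psi> z) \<le> 1"
    "\<And>z. cmod z < 1 \<Longrightarrow> z * deriv F z * (1 - z * \<psi> z) = F z * (1 + z * \<psi> z)"
proof -
  have holF: "F holomorphic_on ball 0 1" and inj: "inj_on F (ball 0 1)" and F0: "F 0 = 0"
    using F by (auto simp: starlike_function_def)
  define G where "G = (\<lambda>z. if z = 0 then deriv F 0 else F z / z)"
  have holG: "G holomorphic_on ball 0 1"
    using pole_lemma_open[OF holF open_ball, of 0] by (simp add: G_def F0 cong: if_cong)
  have FG: "F z = z * G z" for z
    by (simp add: G_def F0 cong: if_cong)
  have G: "G z \<noteq> 0" if "cmod z < 1" for z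
  proof (cases "z = 0")
    case True
    thus ?thesis
      using holomorphic_injective_imp_regular[OF holF open_ball inj, of 0] by (simp add: G_def)
  next
    case False
    thus ?thesis using inj_onD[OF inj, of z 0] that by (auto simp: G_def F0)
  qed
  define H where "H = (\<lambda>z. deriv G z / G z)"
  have holH: "H holomorphic_on ball 0 1"
    unfolding H_def using G by (intro holomorphic_intros holG) auto
  have dF: "z * deriv F z = F z * (1 + z * H z)" if z: "cmod z < 1" for z
  proof -
    have "(G has_field_derivative deriv G z) (at z)"
      using holG z by (intro holomorphic_derivI[of _ "ball 0 1"]) auto
    hence "((\<lambda>z. z * G z) has_field_derivative G z + z * deriv G z) (at z)"
      by (auto intro!: derivative_eq_intros)
    hence "deriv F z = G z + z * deriv G z"
      using DERIV_imp_deriv[of "\<lambda>z. z * G z"] FG[abs_def] by (simp only:)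
    thus ?thesis using G[OF z] unfolding H_def FG by (simp add: field_simps)
  qed
  have q: "0 \<le> Re (1 + z * H z)" if z: "cmod z < 1" for z
  proof (cases "z = 0")
    case False
    define u where "u = 1 + z * H z"
    have "deriv F z \<noteq> 0"
      using holomorphic_injective_imp_regular[OF holF open_ball inj, of z] z by simp
    moreover have "F z \<noteq> 0" using FG[of z] G[OF z] False by simp
    ultimately have "F z / deriv F z = z / u"
      using dF[OF z] False unfolding u_def[symmetric] by (auto simp: field_simps)
    hence "0 \<le> Re (cnj z * z / u)"
      using starlike_function_Re_nonneg[OF F z] by simp
    also have "cnj z * z / u = of_real ((cmod z)\<^sup>2) * inverse u"
      using complex_norm_square[of z] by (simp add: divide_inverse mult.commute[of "cnj z"])
    also have "Re \<dots> = (cmod z)\<^sup>2 * (Re u / (cmod u)\<^sup>2)"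
      by (simp add: cmod_power2)
    finally have "0 \<le> Re u / (cmod u)\<^sup>2" using False by (subst (asm) zero_le_mult_iff) auto
    thus ?thesis unfolding u_def[symmetric] by (cases "u = 0") (auto simp: zero_le_divide_iff)
  qed simp
  have ne: "2 + z * H z \<noteq> 0" if "cmod z < 1" for z
  proof
    assume "2 + z * H z = 0"
    hence "1 + z * H z = 0 - 1" 
      by (simp add: eq_diff_eq)
    hence "Re (1 + z * H z) = - 1" by (simp only: minus_complex.sel) simp
    thus False using q[OF that] by linarith
  qed
  define \<psi> where "\<psi> = (\<lambda>z. H z / (2 + z * H z))"
  have hol\<psi>: "\<psi> holomorphic_on ball 0 1"
    unfolding \<psi>_def using ne by (intro holomorphic_intros holH) auto
  have "cmod (z * \<psi> z) \<le> 1" if "cmod z < 1" for z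
  proof -
    have "(cmod (z * H z))\<^sup>2 \<le> (cmod (2 + z * H z))\<^sup>2"
      using q[OF that] unfolding cmod_power2 by (simp add: power2_eq_square algebra_simps)
    hence "cmod (z * H z) \<le> cmod (2 + z * H z)"
      by (rule power2_le_imp_le) simp
    thus ?thesis using ne[OF that] by (simp add: \<psi>_def norm_divide norm_mult divide_le_eq_1)
  qed
  hence bound: "cmod (\<psi> z) \<le> 1" if "cmod z < 1" for z
    using Schwarz_quotient_bound[OF hol\<psi> _ that] by blast
  have "z * deriv F z * (1 - z * \<psi> z) = F z * (1 + z * \<psi> z)" if z: "cmod z < 1" for z
  proof -
    have "1 - z * \<psi> z = 2 / (2 + z * H z)" "1 + z * \<psi> z = (1 + z * H z) * (2 / (2 + z * H z))"
      using ne[OF z] by (simp_all add: \<psi>_def field_simps)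
    thus ?thesis using dF[OF z] by simp
  qed
  thus thesis using that hol\<psi> bound by blast
qed

subsection \<open>The second coefficient\<close>

text \<open>
  \<open>R\<close> and \<open>R'\<close> are the value and the derivative at \<open>x = - P\<close> of
  \<open>F' x / F x = (1 + x \<psi> x) / (x (1 - x \<psi> x))\<close>, where \<open>s = \<psi> (- P)\<close>, \<open>d = \<psi>' (- P)\<close> and \<open>e\<close> is the
  derivative of \<open>x \<psi> x\<close>.
\<close>

lemma second_coefficient_identity:
  fixes P s d e :: complex
  assumes "P \<noteq> 0" "1 - P\<^sup>2 \<noteq> 0" "1 + P * s \<noteq> 0" "1 - P * s \<noteq> 0"
    and e: "e = s - P * d"
  defines "R \<equiv> (1 - P * s) / (- P * (1 + P * s))"
    and "R' \<equiv> (e * (- P * (1 + P * s)) - (1 - P * s) * ((1 + P * s) + P * e)) / (- P * (1 + P * s))\<^sup>2"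
  shows "((2 * P * (1 - P\<^sup>2) * R + (1 - P\<^sup>2) * (R' * (1 - P\<^sup>2))) / ((1 - P\<^sup>2) * R) - (1 - P\<^sup>2) * R) / 2
    = 1 / P - P * (1 - P\<^sup>2) * (d - s\<^sup>2) / (1 - P\<^sup>2 * s\<^sup>2)"
proof -
  define u v where "u = 1 + P * s" and "v = 1 - P * s"
  have uv: "u \<noteq> 0" "v \<noteq> 0" "1 - P\<^sup>2 * s\<^sup>2 = u * v"
    using assms by (auto simp: u_def v_def power2_eq_square algebra_simps)
  have RR: "R' / R = e / v - 1 / (- P) + e / u"
  proof -
    have "R' = (e * (- P * u) - v * (u + P * e)) / (P\<^sup>2 * u\<^sup>2)" "R = v / (- P * u)"
      by (simp_all add: R_def R'_def u_def v_def power_mult_distrib)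
    hence "R' / R = (e * (- P * u) - v * (u + P * e)) / (P\<^sup>2 * u\<^sup>2) / (v / (- P * u))"
      by (simp only:)
    also have "\<dots> = e / v - 1 / (- P) + e / u"
      using uv(1,2) \<open>P \<noteq> 0\<close> by (simp add: divide_simps) (simp add: power2_eq_square algebra_simps)
    finally show ?thesis .
  qed
  have R0: "R \<noteq> 0" using assms by (simp add: R_def)
  have "((2 * P * (1 - P\<^sup>2) * R + (1 - P\<^sup>2) * (R' * (1 - P\<^sup>2))) / ((1 - P\<^sup>2) * R) - (1 - P\<^sup>2) * R) / 2
      = (2 * P + (1 - P\<^sup>2) * (R' / R) - (1 - P\<^sup>2) * R) / 2"
    using R0 assms(2) by (simp add: field_simps)
  also have "\<dots> = (2 * P + (1 - P\<^sup>2) * (e / v - 1 / (- P) + e / u) - (1 - P\<^sup>2) * (v / (- P * u))) / 2"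
    unfolding RR by (simp add: R_def u_def v_def)
  also have "\<dots> = 1 / P - P * (1 - P\<^sup>2) * (d - s\<^sup>2) / (u * v)"
    using uv \<open>P \<noteq> 0\<close> unfolding e
    by (simp add: divide_simps) (simp add: u_def v_def power2_eq_square algebra_simps)
  finally show ?thesis unfolding uv(3) .
qed

lemma second_coefficient:
  fixes p :: real and F \<psi> f :: "complex \<Rightarrow> complex"
  assumes p: "0 < p" "p < 1"
    and holF: "F holomorphic_on ball 0 1" and hol\<psi>: "\<psi> holomorphic_on ball 0 1"
    and bound: "\<And>z. cmod z < 1 \<Longrightarrow> cmod (\<psi> z) \<le> 1"
    and rel: "\<And>z. cmod z < 1 \<Longrightarrow> z * deriv F z * (1 - z * \<psi> z) = F z * (1 + z * \<psi> z)"
    and nz: "\<And>z. cmod z < 1 \<Longrightarrow> z \<noteq> 0 \<Longrightarrow> F z \<noteq> 0"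
    and f: "\<And>z. cmod z < p \<Longrightarrow> f z = w\<^sub>0 + inverse (F (Moebius_function 0 p z))"
    and f1: "deriv f 0 = 1"
  shows "taylor_coeff 2 f = 1 / p - p * (1 - p\<^sup>2) * (deriv \<psi> (- p) - (\<psi> (- p))\<^sup>2) / (1 - p\<^sup>2 * (\<psi> (- p))\<^sup>2)"
proof -
  define P where "P = complex_of_real p"
  define M where "M = Moebius_function 0 P"
  have Meq: "M z = (z - P) / (1 - P * z)" for z
    by (simp add: M_def Moebius_function_simple P_def)
  have Pn: "cmod P = p" and P0: "P \<noteq> 0" using p by (auto simp: P_def)
  have P1: "1 - P\<^sup>2 \<noteq> 0"
    unfolding P_def using p by (metis abs_of_pos abs_square_less_1 less_irrefl of_real_1 of_real_diff of_real_eq_0_iff of_real_power right_minus_eq)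
  have Mlt: "cmod (M z) < 1" if "cmod z < 1" for z
    unfolding M_def using that p by (intro Moebius_function_norm_lt_1) (auto simp: Pn)
  have prod_ne: "1 - a * b \<noteq> 0" if "cmod a < 1" "cmod b \<le> 1" for a b :: complex
  proof -
    have "cmod (a * b) \<le> cmod a * 1"
      unfolding norm_mult using that by (intro mult_left_mono) auto
    thus ?thesis using that by fastforce
  qed
  have den: "1 - P * z \<noteq> 0" if "cmod z < 1" for z
    using prod_ne[of P z] that p Pn by simp
  have M0: "M z \<noteq> 0" if "cmod z < p" for z
    using den[of z] that p Pn by (auto simp: Meq)
  have y_ne: "1 - z * \<psi> z \<noteq> 0" if "cmod z < 1" for z
    using prod_ne[of z "\<psi> z"] that bound by simp
  have dM: "(M has_field_derivative (1 - P\<^sup>2) / (1 - P * z)\<^sup>2) (at z)" if "cmod z < 1" for z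
    unfolding Meq[abs_def]
    by (rule derivative_eq_intros refl den that)+
       (use den[OF that] in \<open>simp add: divide_simps power2_eq_square algebra_simps\<close>)
  define R where "R = (\<lambda>x. (1 + x * \<psi> x) / (x * (1 - x * \<psi> x)))"
  define A where "A = (\<lambda>z. (1 - P\<^sup>2) / (1 - P * z)\<^sup>2)"
  have df: "(f has_field_derivative - (A z * R (M z) * (f z - w\<^sub>0))) (at z)" if z: "cmod z < p" for z
  proof -
    have z1: "cmod z < 1" using z p by simp
    have x: "cmod (M z) < 1" "M z \<noteq> 0" using Mlt M0 z z1 by auto
    have Fx: "F (M z) \<noteq> 0" using nz x by blast
    have dF: "deriv F (M z) = F (M z) * R (M z)"
      using rel[OF x(1)] y_ne[OF x(1)] x(2) by (simp add: R_def field_simps)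
    have "(F has_field_derivative deriv F (M z)) (at (M z))"
      using holF x by (intro holomorphic_derivI[of _ "ball 0 1"]) auto
    from DERIV_chain2[OF this dM[OF z1]]
    have "((\<lambda>z. F (M z)) has_field_derivative F (M z) * R (M z) * A z) (at z)"
      by (simp add: A_def dF)
    hence "((\<lambda>z. w\<^sub>0 + inverse (F (M z))) has_field_derivative
        - (inverse (F (M z)) * (F (M z) * R (M z) * A z) * inverse (F (M z)))) (at z)"
      using Fx by (auto intro!: derivative_eq_intros)
    also have "inverse (F (M z)) * (F (M z) * R (M z) * A z) * inverse (F (M z)) = A z * R (M z) * (f z - w\<^sub>0)"
      using Fx f[OF z] by (simp add: M_def P_def)
    finally show ?thesis
    proof (rule has_field_derivative_transform_within_open)
      show "w\<^sub>0 + inverse (F (M z)) = f z" if "z \<in> ball 0 p" for z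
        using f[of z] that by (simp add: M_def P_def)
    qed (use z in auto)
  qed
  define s d e where "s = \<psi> (- P)" and "d = deriv \<psi> (- P)" and "e = s - P * d"
  have M00: "M 0 = - P" by (simp add: Meq)
  have us: "1 + P * s \<noteq> 0" "1 - P * s \<noteq> 0"
    using prod_ne[of "- P" s] prod_ne[of P s] bound[of "- P"] p Pn by (auto simp: s_def)
  have dy: "((\<lambda>x. x * \<psi> x) has_field_derivative e) (at (- P))"
  proof -
    have "(\<psi> has_field_derivative d) (at (- P))"
      unfolding d_def using hol\<psi> p Pn by (intro holomorphic_derivI[of _ "ball 0 1"]) auto
    thus ?thesis
      by (auto intro!: derivative_eq_intros simp: e_def s_def)
  qed
  define R' where "R' = (e * (- P * (1 + P * s)) - (1 - P * s) * ((1 + P * s) + P * e)) / (- P * (1 + P * s))\<^sup>2"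
  have "(R has_field_derivative R') (at (M 0))"
    unfolding M00 R_def
    by (rule derivative_eq_intros dy refl)+
       (use us P0 in \<open>auto simp: R'_def s_def power2_eq_square\<close>)
  hence "((\<lambda>z. R (M z)) has_field_derivative R' * (1 - P\<^sup>2)) (at 0)"
    using DERIV_chain2[OF _ dM[of 0], of R] by simp
  moreover have "(A has_field_derivative 2 * P * (1 - P\<^sup>2)) (at 0)"
    unfolding A_def by (auto intro!: derivative_eq_intros)
  ultimately have "((\<lambda>z. - (A z * R (M z) * (f z - w\<^sub>0))) has_field_derivative
      - ((2 * P * (1 - P\<^sup>2) * R (M 0) + A 0 * (R' * (1 - P\<^sup>2))) * (f 0 - w\<^sub>0) + A 0 * R (M 0))) (at 0)"
    using df[of 0] f1 p by (auto intro!: derivative_eq_intros simp: DERIV_imp_deriv algebra_simps)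
  moreover have "(deriv f has_field_derivative D) (at 0)"
    if "((\<lambda>z. - (A z * R (M z) * (f z - w\<^sub>0))) has_field_derivative D) (at 0)" for D
    using that
  proof (rule has_field_derivative_transform_within_open)
    show "- (A z * R (M z) * (f z - w\<^sub>0)) = deriv f z" if "z \<in> ball 0 p" for z
      using df[of z] that by (simp add: DERIV_imp_deriv)
  qed (use p in auto)
  ultimately have "deriv (deriv f) 0 =
      - ((2 * P * (1 - P\<^sup>2) * R (M 0) + A 0 * (R' * (1 - P\<^sup>2))) * (f 0 - w\<^sub>0) + A 0 * R (M 0))"
    by (blast intro: DERIV_imp_deriv)
  moreover have A0: "A 0 = 1 - P\<^sup>2" by (simp add: A_def)
  moreover have "f 0 - w\<^sub>0 = - 1 / (A 0 * R (M 0))"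
  proof -
    have "- (A 0 * R (M 0) * (f 0 - w\<^sub>0)) = 1"
      using DERIV_imp_deriv[OF df[of 0]] f1 p by simp
    moreover from this have "A 0 * R (M 0) \<noteq> 0" by auto
    ultimately show ?thesis by (simp add: eq_divide_eq mult.commute minus_equation_iff)
  qed
  ultimately have "deriv (deriv f) 0 = (2 * P * (1 - P\<^sup>2) * R (M 0) + (1 - P\<^sup>2) * (R' * (1 - P\<^sup>2))) / ((1 - P\<^sup>2) * R (M 0)) - (1 - P\<^sup>2) * R (M 0)"
    by simp
  moreover have "R (M 0) = (1 - P * s) / (- P * (1 + P * s))"
    unfolding M00 by (simp add: R_def s_def)
  moreover have "taylor_coeff 2 f = deriv (deriv f) 0 / 2"
    by (simp add: taylor_coeff_def fps_expansion_def numeral_2_eq_2)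
  ultimately have "taylor_coeff 2 f = 1 / P - P * (1 - P\<^sup>2) * (d - s\<^sup>2) / (1 - P\<^sup>2 * s\<^sup>2)"
    using second_coefficient_identity[OF P0 P1 us e_def] by (simp only: R'_def)
  thus ?thesis by (simp add: P_def s_def d_def)
qed

subsection \<open>Passage to starlike functions\<close>

lemma starlike_function_of_Sigma_star:
  fixes p :: real
  assumes p: "0 < p" "p < 1" and f: "f \<in> Sigma_star p w\<^sub>0"
  obtains F :: "complex \<Rightarrow> complex" where "starlike_function F"
    "\<And>z. cmod z < p \<Longrightarrow> f z = w\<^sub>0 + inverse (F (Moebius_function 0 p z))"
proof -
  define P where "P = complex_of_real p"
  have P: "cmod P < 1" "cmod (- P) < 1" using p by (auto simp: P_def)
  define K where "K = (\<lambda>z. if z = P then 0 else inverse (f z - w\<^sub>0))"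
  have nice: "f nicely_meromorphic_on ball 0 1" and inj: "inj_on (sphere_map f) (ball 0 1)"
    and pole: "\<And>z. cmod z < 1 \<Longrightarrow> is_pole f z \<longleftrightarrow> z = P"
    and star: "starlike_wrt w\<^sub>0 (UNIV - sphere_map f ` ball 0 1)"
    using f by (auto simp: Sigma_star_def P_def)
  have sph: "sphere_map f z = Some (f z)" if "cmod z < 1" "z \<noteq> P" for z
    using that pole by (simp add: sphere_map_def)
  have holf: "f holomorphic_on ball 0 1 - {P}"
  proof (rule analytic_imp_holomorphic)
    show "f analytic_on ball 0 1 - {P}"
      unfolding analytic_on_analytic_at[of _ "ball 0 1 - {P}"]
      using nicely_meromorphic_on_imp_analytic_at[OF nice] pole by auto
  qed
  have ne: "f z - w\<^sub>0 \<noteq> 0" if "cmod z < 1" "z \<noteq> P" for z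
  proof
    assume "f z - w\<^sub>0 = 0"
    hence "Some w\<^sub>0 = sphere_map f z" using sph[OF that] by simp
    thus False using star that unfolding starlike_wrt_def by auto
  qed
  have K0: "K z = 0 \<longleftrightarrow> z = P" if "cmod z < 1" for z
    using ne[OF that] by (simp add: K_def)
  have holK: "K holomorphic_on ball 0 1"
    unfolding K_def
  proof (rule is_pole_inverse_holomorphic)
    show "is_pole (\<lambda>z. f z - w\<^sub>0) P"
      using pole[of P] P by (simp add: is_pole_minus_const_iff)
  qed (use ne in \<open>auto intro!: holomorphic_intros holf\<close>)
  have injK: "inj_on K (ball 0 1)"
  proof (rule inj_onI)
    fix x y assume xy: "x \<in> ball 0 1" "y \<in> ball 0 1" "K x = K y"
    show "x = y"
    proof (cases "x = P \<or> y = P")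
      case True thus ?thesis using xy K0 by (metis mem_ball_0)
    next
      case False
      hence "f x = f y" using xy by (simp add: K_def)
      hence "sphere_map f x = sphere_map f y" using sph[of x] sph[of y] xy False by simp
      thus ?thesis using inj xy by (simp add: inj_on_eq_iff)
    qed
  qed
  have starK: "of_real t * K z \<in> K ` ball 0 1" if z: "cmod z < 1" and t: "0 \<le> t" "t \<le> 1" for z t
  proof (cases "z = P \<or> t = 0")
    case True
    hence "of_real t * K z = K P" by (auto simp: K_def)
    thus ?thesis using P by (metis imageI mem_ball_0)
  next
    case False
    define w where "w = w\<^sub>0 + (f z - w\<^sub>0) / of_real t"
    have "of_real t * (w - w\<^sub>0) = f z - w\<^sub>0"
      using False by (simp add: w_def)
    hence "f z = w\<^sub>0 + of_real t * (w - w\<^sub>0)" by simp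
    hence "f z = (1 - t) *\<^sub>R w\<^sub>0 + t *\<^sub>R w"
      by (simp add: scaleR_conv_of_real algebra_simps)
    hence "f z \<in> closed_segment w\<^sub>0 w"
      using t by (auto simp: in_segment)
    moreover have "Some (f z) \<in> sphere_map f ` ball 0 1"
      using sph[of z] z False by (metis imageI mem_ball_0)
    ultimately have "Some w \<in> sphere_map f ` ball 0 1"
      using star unfolding starlike_wrt_def by blast
    then obtain y where y: "cmod y < 1" "sphere_map f y = Some w" by auto
    hence "y \<noteq> P" "f y = w" using pole[of y] by (auto simp: sphere_map_def split: if_splits)
    hence "K y = of_real t * K z"
      using False by (simp add: K_def w_def divide_inverse mult.commute)
    thus ?thesis using y by (metis imageI mem_ball_0)
  qed
  define M where "M = Moebius_function 0 P"
  define N where "N = Moebius_function 0 (- P)"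
  have NM: "N (M z) = z" and MN: "M (N z) = z" if "cmod z < 1" for z
    unfolding M_def N_def using that P by (auto intro!: Moebius_function_compose)
  have Nlt: "cmod (N z) < 1" and Mlt: "cmod (M z) < 1" if "cmod z < 1" for z
    unfolding M_def N_def using that P by (auto intro!: Moebius_function_norm_lt_1)
  define F where "F = K \<circ> N"
  have imN: "N ` ball 0 1 = ball 0 1"
  proof (intro equalityI subsetI)
    show "z \<in> N ` ball 0 1" if "z \<in> ball 0 1" for z
      using that NM[of z] Mlt[of z] by (intro image_eqI[of _ _ "M z"]) auto
  qed (use Nlt in auto)
  have imF: "F ` ball 0 1 = K ` ball 0 1"
    unfolding F_def image_comp[symmetric] imN ..
  have "starlike_function F"
    unfolding starlike_function_def imF
  proof (intro conjI ballI)
    show "F holomorphic_on ball 0 1"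
      unfolding F_def
    proof (rule holomorphic_on_compose_gen)
      show "N holomorphic_on ball 0 1" unfolding N_def by (rule Moebius_function_holomorphic[OF P(2)])
    qed (use holK imN in auto)
    show "inj_on F (ball 0 1)"
      unfolding F_def
    proof (rule comp_inj_on)
      show "inj_on N (ball 0 1)" by (rule inj_on_inverseI[of _ M]) (use MN in auto)
    qed (use injK imN in auto)
    show "F 0 = 0" by (simp add: F_def N_def Moebius_function_simple K_def)
    show "of_real t * F z \<in> K ` ball 0 1" if "z \<in> ball 0 1" "t \<in> {0..1}" for z t
      using starK[of "N z" t] Nlt[of z] that by (simp add: F_def)
  qed
  moreover have "f z = w\<^sub>0 + inverse (F (M z))" if "cmod z < p" for z
  proof -
    have "cmod z < 1" "z \<noteq> P" using that p by (auto simp: P_def)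
    thus ?thesis using NM by (simp add: F_def K_def)
  qed
  ultimately show thesis using that by (simp add: M_def P_def)
qed

lemma Sigma_star_of_starlike_function:
  fixes p :: real and F :: "complex \<Rightarrow> complex"
  assumes p: "0 < p" "p < 1" and F: "starlike_function F"
    and norm: "(1 - p\<^sup>2) * deriv F (- p) = - (F (- p))\<^sup>2"
  obtains f w\<^sub>0 where "w\<^sub>0 \<noteq> 0" "f \<in> Sigma_star p w\<^sub>0"
    "\<And>z. cmod z < p \<Longrightarrow> f z = w\<^sub>0 + inverse (F (Moebius_function 0 p z))"
proof -
  define P where "P = complex_of_real p"
  have P: "cmod P < 1" "cmod (- P) < 1" "P \<noteq> 0" using p by (auto simp: P_def)
  have holF: "F holomorphic_on ball 0 1" and inj: "inj_on F (ball 0 1)" and F0: "F 0 = 0"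
    and star: "\<And>z t. \<lbrakk>cmod z < 1; 0 \<le> t; t \<le> 1\<rbrakk> \<Longrightarrow> of_real t * F z \<in> F ` ball 0 1"
    using F by (auto simp: starlike_function_def)
  define M where "M = Moebius_function 0 P"
  define N where "N = Moebius_function 0 (- P)"
  have Meq: "M z = (z - P) / (1 - P * z)" for z
    by (simp add: M_def Moebius_function_simple P_def)
  have NM: "N (M z) = z" and MN: "M (N z) = z" if "cmod z < 1" for z
    unfolding M_def N_def using that P by (auto intro!: Moebius_function_compose)
  have Nlt: "cmod (N z) < 1" and Mlt: "cmod (M z) < 1" if "cmod z < 1" for z
    unfolding M_def N_def using that P by (auto intro!: Moebius_function_norm_lt_1)
  define K where "K = F \<circ> M"
  have imM: "M ` ball 0 1 = ball 0 1"
  proof (intro equalityI subsetI)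
    show "z \<in> M ` ball 0 1" if "z \<in> ball 0 1" for z
      using that MN[of z] Nlt[of z] by (intro image_eqI[of _ _ "N z"]) auto
  qed (use Mlt in auto)
  have holK: "K holomorphic_on ball 0 1"
    unfolding K_def
  proof (rule holomorphic_on_compose_gen)
    show "M holomorphic_on ball 0 1" unfolding M_def by (rule Moebius_function_holomorphic[OF P(1)])
  qed (use holF imM in auto)
  have injK: "inj_on K (ball 0 1)"
    unfolding K_def
  proof (rule comp_inj_on)
    show "inj_on M (ball 0 1)" by (rule inj_on_inverseI[of _ N]) (use NM in auto)
  qed (use inj imM in auto)
  have imK: "K ` ball 0 1 = F ` ball 0 1"
    unfolding K_def image_comp[symmetric] imM ..
  have starK: "of_real t * K z \<in> K ` ball 0 1" if "cmod z < 1" "0 \<le> t" "t \<le> 1" for z t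
    unfolding imK using star[of "M z" t] Mlt[of z] that by (simp add: K_def)
  have KP: "K P = 0" by (simp add: K_def Meq F0)
  have K_ne: "K z \<noteq> 0" if "cmod z < 1" "z \<noteq> P" for z
    using inj_onD[OF injK, of z P] that P KP by auto
  define w\<^sub>0 where "w\<^sub>0 = - inverse (K 0)"
  have w0: "w\<^sub>0 \<noteq> 0" using K_ne[of 0] P by (simp add: w\<^sub>0_def)
  define f where "f = (\<lambda>z. if z = P then 0 else w\<^sub>0 + inverse (K z))"
  have f: "f z = w\<^sub>0 + inverse (K z)" if "z \<noteq> P" for z
    using that by (simp add: f_def)
  have opn: "open (ball 0 1 - {P})" by (intro open_Diff) auto
  have holf: "f holomorphic_on ball 0 1 - {P}"
  proof (rule holomorphic_transform)
    show "(\<lambda>z. w\<^sub>0 + inverse (K z)) holomorphic_on ball 0 1 - {P}"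
      using K_ne by (intro holomorphic_intros holomorphic_on_subset[OF holK]) auto
  qed (simp add: f)
  have poleP: "is_pole f P"
  proof -
    have "isCont K P"
      using holK P by (intro continuous_on_interior[OF holomorphic_on_imp_continuous_on]) (auto simp: interior_open)
    hence "K \<midarrow>P\<rightarrow> 0" using KP by (simp add: isCont_def)
    moreover have "\<forall>\<^sub>F z in at P. z \<in> ball 0 1 - {P}"
      using P by (intro eventually_at_in_open) auto
    hence "\<forall>\<^sub>F z in at P. K z \<noteq> 0"
      by (rule eventually_mono) (use K_ne in auto)
    ultimately have "filterlim K (at 0) (at P)" by (simp add: filterlim_at)
    hence "is_pole (\<lambda>z. 1 / K z) P" by (intro is_pole_divide) auto
    hence "is_pole (\<lambda>z. 1 / K z + w\<^sub>0) P" by (rule is_pole_plus_const_iff[THEN iffD1])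
    moreover have "is_pole f P \<longleftrightarrow> is_pole (\<lambda>z. 1 / K z + w\<^sub>0) P"
      by (rule is_pole_cong) (simp_all add: eventually_at_filter f divide_inverse)
    ultimately show ?thesis by simp
  qed
  have pole_iff: "is_pole f z \<longleftrightarrow> z = P" if "cmod z < 1" for z
    using not_is_pole_holomorphic[OF opn _ holf, of z] poleP that by auto
  have sph: "sphere_map f z = (if z = P then None else Some (w\<^sub>0 + inverse (K z)))" if "cmod z < 1" for z
    using pole_iff[OF that] f by (simp add: sphere_map_def)
  have "f \<in> Sigma_star p w\<^sub>0"
    unfolding Sigma_star_def P_def[symmetric]
  proof (intro CollectI conjI)
    show "f nicely_meromorphic_on ball 0 1"
    proof (rule nicely_meromorphic_onI_open)
      show "f analytic_on ball 0 1 - {P}"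
        using holf opn by (simp add: analytic_on_open)
      show "isolated_singularity_at f z" if "z \<in> ball 0 1" for z
      proof (rule isolated_singularity_at_holomorphic)
        show "f holomorphic_on (ball 0 1 - ({P} - {z})) - {z}"
          by (rule holomorphic_on_subset[OF holf]) auto
        show "open (ball 0 1 - ({P} - {z}))" by (intro open_Diff finite_imp_closed) auto
      qed (use that in auto)
    qed (use poleP in \<open>auto simp: f_def\<close>)
    show "inj_on (sphere_map f) (ball 0 1)"
    proof (rule inj_onI)
      fix x y assume xy: "x \<in> ball 0 1" "y \<in> ball 0 1" "sphere_map f x = sphere_map f y"
      thus "x = y"
        using sph[of x] sph[of y] inj_onD[OF injK, of x y] by (auto split: if_splits)
    qed
    show "\<forall>z\<in>ball 0 1. is_pole f z \<longleftrightarrow> z = P" using pole_iff by auto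
    show "zorder f P = - 1"
    proof -
      define Q where "Q = (\<lambda>z. if z = P then deriv K P else K z / (z - P))"
      have holQ: "Q holomorphic_on ball 0 1"
        unfolding Q_def using pole_lemma_open[OF holK open_ball, of P] by (simp add: KP cong: if_cong)
      have Q: "Q z \<noteq> 0" if "cmod z < 1" for z
        using holomorphic_injective_imp_regular[OF holK open_ball injK, of P] K_ne[OF that] P
        by (auto simp: Q_def)
      show ?thesis
      proof (rule zorder_eqI)
        show "(\<lambda>z. w\<^sub>0 * (z - P) + inverse (Q z)) holomorphic_on ball 0 1"
          using Q by (intro holomorphic_intros holQ) auto
        show "f z = (w\<^sub>0 * (z - P) + inverse (Q z)) * (z - P) powi - 1" if "z \<in> ball 0 1" "z \<noteq> P" for z
          using that by (simp add: f Q_def power_int_minus field_simps)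
      qed (use P Q in auto)
    qed
    show "f 0 = 0" using P by (simp add: f_def w\<^sub>0_def)
    show "deriv f 0 = 1"
    proof (rule DERIV_imp_deriv)
      have M0: "M 0 = - P" by (simp add: Meq)
      have "(M has_field_derivative 1 - P\<^sup>2) (at 0)"
        unfolding Meq[abs_def] by (auto intro!: derivative_eq_intros simp: power2_eq_square)
      moreover have "(F has_field_derivative deriv F (- P)) (at (M 0))"
        unfolding M0 using holF P by (intro holomorphic_derivI[of _ "ball 0 1"]) auto
      ultimately have "(K has_field_derivative deriv F (- P) * (1 - P\<^sup>2)) (at 0)"
        unfolding K_def o_def by (rule DERIV_chain2[rotated])
      moreover have "deriv F (- P) * (1 - P\<^sup>2) = - (K 0)\<^sup>2"
        using norm by (simp add: K_def M0 P_def mult.commute)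
      ultimately have "(K has_field_derivative - (K 0)\<^sup>2) (at 0)" by simp
      hence "((\<lambda>z. w\<^sub>0 + inverse (K z)) has_field_derivative 1) (at 0)"
        using K_ne[of 0] P by (auto intro!: derivative_eq_intros simp: power2_eq_square field_simps)
      thus "(f has_field_derivative 1) (at 0)"
        by (rule has_field_derivative_transform_within_open[where S = "ball 0 1 - {P}"])
           (use P opn f in auto)
    qed
    show "starlike_wrt w\<^sub>0 (UNIV - sphere_map f ` ball 0 1)"
      unfolding starlike_wrt_def
    proof (intro conjI allI impI subsetI)
      show "Some w\<^sub>0 \<in> UNIV - sphere_map f ` ball 0 1"
        using sph K_ne by (auto simp: image_iff)
    next
      fix w v assume w: "Some w \<in> UNIV - sphere_map f ` ball 0 1"
        and v: "v \<in> Some ` closed_segment w\<^sub>0 w"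
      then obtain u where u: "0 \<le> u" "u \<le> 1" "v = Some (w\<^sub>0 + of_real u * (w - w\<^sub>0))"
        by (auto simp: in_segment scaleR_conv_of_real algebra_simps)
      show "v \<in> UNIV - sphere_map f ` ball 0 1"
      proof (rule ccontr)
        assume "v \<notin> UNIV - sphere_map f ` ball 0 1"
        then obtain z where z: "cmod z < 1" "sphere_map f z = v" by auto
        hence zP: "z \<noteq> P" and eq: "inverse (K z) = of_real u * (w - w\<^sub>0)"
          using sph[of z] u by (auto split: if_splits)
        obtain y where y: "cmod y < 1" "K y = of_real u * K z"
          using starK[OF z(1) u(1,2)] by auto
        have "u \<noteq> 0" using eq K_ne[OF z(1) zP] by auto
        hence "y \<noteq> P" using K_ne[OF z(1) zP] y KP by auto
        moreover have "inverse (K y) = w - w\<^sub>0"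
          using \<open>u \<noteq> 0\<close> by (simp only: y(2) inverse_mult_distrib eq) (simp add: divide_simps)
        ultimately have "sphere_map f y = Some w" using sph[of y] y by simp
        thus False using w y by (metis DiffD2 imageI mem_ball_0)
      qed
    qed
  qed
  moreover have "f z = w\<^sub>0 + inverse (F (M z))" if "cmod z < p" for z
  proof -
    have "z \<noteq> P" using that p by (auto simp: P_def)
    thus ?thesis by (simp add: f K_def)
  qed
  ultimately show thesis using that w0 by (simp add: M_def P_def)
qed

subsection \<open>The set of variability\<close>

lemma starlike_function_cmult:
  assumes F: "starlike_function F" and c: "c \<noteq> 0"
  shows "starlike_function (\<lambda>z. c * F z)"
  unfolding starlike_function_def
proof (intro conjI ballI)
  show "(\<lambda>z. c * F z) holomorphic_on ball 0 1"
    using F by (intro holomorphic_intros) (auto simp: starlike_function_def)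
  show "inj_on (\<lambda>z. c * F z) (ball 0 1)" "c * F 0 = 0"
    using F c by (auto simp: starlike_function_def inj_on_def)
  show "of_real t * (c * F z) \<in> (\<lambda>z. c * F z) ` ball 0 1" if zt: "z \<in> ball 0 1" "t \<in> {0..1}" for z t
  proof -
    have "of_real t * F z \<in> F ` ball 0 1"
      using F zt by (simp add: starlike_function_def)
    then obtain y where y: "y \<in> ball 0 1" "of_real t * F z = F y" by blast
    hence "of_real t * (c * F z) = c * F y" by (metis mult.left_commute)
    thus ?thesis using y by blast
  qed
qed

lemma starlike_function_nonzero:
  assumes "starlike_function F" "cmod z < 1" "z \<noteq> 0"
  shows "F z \<noteq> 0"
  using assms inj_onD[of F "ball 0 1" z 0] by (auto simp: starlike_function_def)

lemma second_coefficient_bound: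
  fixes p :: real and s d :: complex
  assumes p: "0 < p" "p < 1" and s: "cmod s \<le> 1"
    and d: "(1 - p\<^sup>2) * cmod d \<le> 1 - (cmod s)\<^sup>2"
  shows "cmod (p * (1 - p\<^sup>2) * (d - s\<^sup>2) / (1 - p\<^sup>2 * s\<^sup>2)) \<le> p"
proof -
  have p2: "0 < 1 - p\<^sup>2" "p\<^sup>2 < 1"
    using p by (simp_all add: abs_square_less_1)
  have "cmod (of_real (p\<^sup>2) * s\<^sup>2) = p\<^sup>2 * (cmod s)\<^sup>2"
    by (simp add: norm_mult norm_power)
  hence den: "1 - p\<^sup>2 * (cmod s)\<^sup>2 \<le> cmod (1 - of_real (p\<^sup>2) * s\<^sup>2)"
    using norm_triangle_ineq2[of 1 "of_real (p\<^sup>2) * s\<^sup>2"] by simp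
  have "p\<^sup>2 * (cmod s)\<^sup>2 \<le> p\<^sup>2 * 1"
    using s by (intro mult_left_mono) (auto simp: abs_square_le_1)
  hence pos: "0 < cmod (1 - of_real (p\<^sup>2) * s\<^sup>2)"
    using den p2 by linarith
  have "(1 - p\<^sup>2) * cmod (d - s\<^sup>2) \<le> (1 - p\<^sup>2) * (cmod d + (cmod s)\<^sup>2)"
    using p2 norm_triangle_ineq4[of d "s\<^sup>2"] by (intro mult_left_mono) (auto simp: norm_power)
  also have "\<dots> \<le> 1 - p\<^sup>2 * (cmod s)\<^sup>2"
    using d by (simp add: algebra_simps)
  also note den
  finally have "p * ((1 - p\<^sup>2) * cmod (d - s\<^sup>2)) \<le> p * cmod (1 - of_real (p\<^sup>2) * s\<^sup>2)"
    using p by (intro mult_left_mono) auto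
  moreover have "cmod (of_real p * of_real (1 - p\<^sup>2) * (d - s\<^sup>2)) = p * ((1 - p\<^sup>2) * cmod (d - s\<^sup>2))"
    unfolding norm_mult norm_of_real using p p2 by simp
  ultimately show ?thesis
    using pos by (simp add: norm_divide divide_le_eq)
qed

theorem theorem2p8:
  fixes p :: real
  assumes "0 < p" and "p < 1"
  shows "{taylor_coeff 2 f |f. \<exists>w\<^sub>0. w\<^sub>0 \<noteq> 0 \<and> f \<in> Sigma_star p w\<^sub>0} =
         {a. cmod (a - 1 / of_real p) \<le> p}"
proof (intro equalityI subsetI)
  fix a assume "a \<in> {taylor_coeff 2 f |f. \<exists>w\<^sub>0. w\<^sub>0 \<noteq> 0 \<and> f \<in> Sigma_star p w\<^sub>0}"
  then obtain f w\<^sub>0 where a: "a = taylor_coeff 2 f" and f: "f \<in> Sigma_star p w\<^sub>0" by blast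
  obtain F where F: "starlike_function F"
    and fF: "\<And>z. cmod z < p \<Longrightarrow> f z = w\<^sub>0 + inverse (F (Moebius_function 0 p z))"
    using starlike_function_of_Sigma_star[OF assms f] by blast
  obtain \<psi> where hol: "\<psi> holomorphic_on ball 0 1"
    and bound: "\<And>z. cmod z < 1 \<Longrightarrow> cmod (\<psi> z) \<le> 1"
    and rel: "\<And>z. cmod z < 1 \<Longrightarrow> z * deriv F z * (1 - z * \<psi> z) = F z * (1 + z * \<psi> z)"
    using starlike_function_Schur[OF F] by blast
  have holF: "F holomorphic_on ball 0 1" using F by (simp add: starlike_function_def)
  have f1: "deriv f 0 = 1" using f by (simp add: Sigma_star_def)
  have p1: "cmod (complex_of_real (- p)) < 1" using assms by simp
  have "(1 - p\<^sup>2) * cmod (deriv \<psi> (- p)) \<le> 1 - (cmod (\<psi> (- p)))\<^sup>2"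
    using Schwarz_Pick_deriv[OF hol bound p1] by simp
  from second_coefficient_bound[OF assms bound[OF p1] this]
  show "a \<in> {a. cmod (a - 1 / of_real p) \<le> p}"
    using second_coefficient[OF assms holF hol bound rel starlike_function_nonzero[OF F] fF f1] a
    by (simp add: norm_minus_commute)
next
  fix a assume a: "a \<in> {a. cmod (a - 1 / of_real p) \<le> p}"
  define P where "P = complex_of_real p"
  have P: "cmod P < 1" "cmod (- P) < 1" "P \<noteq> 0" using assms by (auto simp: P_def)
  have P2: "1 - P\<^sup>2 \<noteq> 0"
  proof -
    have "p\<^sup>2 < 1" using assms by (simp add: abs_square_less_1)
    hence "of_real (1 - p\<^sup>2) \<noteq> (0 :: complex)" unfolding of_real_eq_0_iff by simp
    thus ?thesis by (simp add: P_def)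
  qed
  define t where "t = (1 / P - a) / P"
  have t: "cmod t \<le> 1"
    using a assms by (simp add: t_def P_def norm_divide norm_minus_commute)
  define \<psi> where "\<psi> = (\<lambda>z. t * Moebius_function 0 (- P) z)"
  have hol: "\<psi> holomorphic_on ball 0 1"
    unfolding \<psi>_def by (intro holomorphic_intros Moebius_function_holomorphic P)
  have bound: "cmod (\<psi> z) \<le> 1" if "cmod z < 1" for z
    using mult_mono[OF t less_imp_le[OF Moebius_function_norm_lt_1[OF P(2) that, of 0]]]
    by (simp add: \<psi>_def norm_mult)
  obtain F where F: "starlike_function F"
    and rel: "\<And>z. cmod z < 1 \<Longrightarrow> z * deriv F z * (1 - z * \<psi> z) = F z * (1 + z * \<psi> z)"
    using starlike_function_exists[OF hol bound] by blast
  have holF: "F holomorphic_on ball 0 1" and inj: "inj_on F (ball 0 1)"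
    using F by (simp_all add: starlike_function_def)
  have FP: "F (- P) \<noteq> 0" "deriv F (- P) \<noteq> 0"
    using starlike_function_nonzero[OF F, of "- P"]
      holomorphic_injective_imp_regular[OF holF open_ball inj, of "- P"] P by auto
  define c where "c = - (1 - P\<^sup>2) * deriv F (- P) / (F (- P))\<^sup>2"
  have c: "c \<noteq> 0" using FP P2 by (simp add: c_def)
  define G where "G = (\<lambda>z. c * F z)"
  have G: "starlike_function G"
    unfolding G_def by (rule starlike_function_cmult[OF F c])
  have holG: "G holomorphic_on ball 0 1" using G by (simp add: starlike_function_def)
  have dG: "deriv G z = c * deriv F z" if "cmod z < 1" for z
    unfolding G_def using holF that
    by (intro deriv_cmult holomorphic_on_imp_differentiable_at[of _ "ball 0 1"]) auto
  have relG: "z * deriv G z * (1 - z * \<psi> z) = G z * (1 + z * \<psi> z)" if "cmod z < 1" for z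
    using rel[OF that] dG[OF that] unfolding G_def by (metis mult.assoc mult.left_commute)
  have "c * (F (- P))\<^sup>2 = - (1 - P\<^sup>2) * deriv F (- P)"
    using FP by (simp add: c_def)
  moreover have "(G (- P))\<^sup>2 = c * (c * (F (- P))\<^sup>2)"
    by (simp add: G_def power_mult_distrib power2_eq_square)
  ultimately have "(G (- P))\<^sup>2 = c * (- (1 - P\<^sup>2) * deriv F (- P))"
    by (simp only:)
  hence "(1 - P\<^sup>2) * deriv G (- P) = - (G (- P))\<^sup>2"
    unfolding dG[OF P(2)] by (simp add: algebra_simps)
  hence "(1 - p\<^sup>2) * deriv G (- p) = - (G (- p))\<^sup>2" by (simp add: P_def)
  from Sigma_star_of_starlike_function[OF assms G this] obtain f w\<^sub>0 where
    w0: "w\<^sub>0 \<noteq> 0" and f: "f \<in> Sigma_star p w\<^sub>0"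
    and fG: "\<And>z. cmod z < p \<Longrightarrow> f z = w\<^sub>0 + inverse (G (Moebius_function 0 p z))"
    by blast
  have f1: "deriv f 0 = 1" using f by (simp add: Sigma_star_def)
  have \<psi>P: "\<psi> (- P) = 0" by (simp add: \<psi>_def Moebius_function_eq_zero)
  have "cnj P = P" by (simp add: P_def)
  hence "(\<psi> has_field_derivative t * (1 / (1 - P\<^sup>2))) (at (- P))"
    unfolding \<psi>_def Moebius_function_simple using P2
    by (auto intro!: derivative_eq_intros simp: power2_eq_square)
  hence "deriv \<psi> (- P) = t / (1 - P\<^sup>2)" by (simp add: DERIV_imp_deriv)
  moreover have "taylor_coeff 2 f = 1 / P - P * (1 - P\<^sup>2) * (deriv \<psi> (- P) - (\<psi> (- P))\<^sup>2) / (1 - P\<^sup>2 * (\<psi> (- P))\<^sup>2)"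
    using second_coefficient[OF assms holG hol bound relG starlike_function_nonzero[OF G] fG f1]
    by (simp add: P_def)
  ultimately have "taylor_coeff 2 f = 1 / P - P * t"
    using P2 by (simp add: \<psi>P)
  hence "taylor_coeff 2 f = a" using P by (simp add: t_def)
  thus "a \<in> {taylor_coeff 2 f |f. \<exists>w\<^sub>0. w\<^sub>0 \<noteq> 0 \<and> f \<in> Sigma_star p w\<^sub>0}"
    using w0 f by blast
qed

end
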